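(* Let $p\ge 2$, $\nu>0$, $\Delta t>0$, let $f_h^{\star}\in\mathbb{V}_h^p$, and suppose $f_h^{k+1}\in\mathbb{V}_h^p$ satisfies the implicit (backward Euler) update $$(f_h^{k+1},\varphi_h)_{ij}=(f_h^{\star},\varphi_h)_{ij}-\Delta t\,\nu\,B_h^{\mathrm{LB}}(f_h^{k+1},\boldsymbol\rho_{f_h}^{k+1},\varphi_h)_{ij}$$ for all $\varphi_h\in\mathbb{V}_h^p$ and all $i=1,\dots,N^x$, $j=1,\dots,N^v$, where $\boldsymbol\rho_{f_h}^{k+1}=\langle\mathbf e f_h^{k+1}\rangle_{D^v}$ and where all spatial integrals over $I_i^x$ in $B_h^{\mathrm{LB}}$ are evaluated with an $N$-point quadrature $\int_{I_i^x}F\,dx\approx\Delta x_i\sum_{m=1}^{N}\tilde W_m F(\tilde x_m)$ with points $\tilde x_1,\dots,\tilde x_N\in I_i^x$ and weights $\tilde W_1,\dots,\tilde W_N$. Then the update conserves particle number, momentum and energy pointwise at the spatial nodes: for every $i$ and every Gauss--Legendre node $x_q\in S_i^x$, $$(\boldsymbol\rho_{f_h}^{k+1})_q^i=(\boldsymbol\rho_{f_h}^{\star})_q^i .$$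
   Context: Notation. $\mathbf e=\mathbf e(v)=(1,v,\tfrac12v^2)^{\mathrm T}$, and $\langle\cdot\rangle_\Omega=\int_\Omega\cdot\,dv$. Expressions with a vector-valued argument are understood componentwise. Mesh. $D^x=[x_{\min},x_{\max}]$ and $D^v=[v_{\min},v_{\max}]$ are bounded intervals, partitioned by $x_{\min}=x_{1/2}<x_{3/2}<\dots<x_{N^x+1/2}=x_{\max}$ and $v_{\min}=v_{1/2}<\dots<v_{N^v+1/2}=v_{\max}$ into elements $I_i^x=(x_{i-1/2},x_{i+1/2})$, $I_j^v=(v_{j-1/2},v_{j+1/2})$, with $\Delta x_i=x_{i+1/2}-x_{i-1/2}$ and $I_{ij}=I_i^x\times I_j^v$. $\mathbb{V}_h^p$ is the space of functions whose restriction to each $I_{ij}$ is a polynomial of degree at most $p$ in $x$ and at most $p$ in $v$ (no continuity across elements). $(a,b)_{ij}=\int_{I_{ij}}ab\,dx\,dv$. A superscript $\pm$ on an argument denotes the one-sided limit from above/below. Nodes and nodal moments. $S_i^x=\{x_1,\dots,x_{p+1}\}\subset I_i^x$ are the $(p+1)$-point Gauss--Legendre nodes on $I_i^x$. For $f_h\in\mathbb{V}_h^p$, $(\boldsymbol\rho_{f_h})_q^i=\sum_{j=1}^{N^v}\int_{I_j^v}\mathbf e(v)\,f_h(x_q,v)\,dv$ for $x_q\in S_i^x$. Moments. For $f_h\in\mathbb{V}_h^p$ and $x\in I_i^x$: $n_{f_h}(x)=\langle f_h(x,\cdot)\rangle_{D^v}$, $u_{f_h}=\frac1{n_{f_h}}\langle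 v f_h\rangle_{D^v}$, $\theta_{f_h}=\frac1{n_{f_h}}\langle (v-u_{f_h})^2f_h\rangle_{D^v}$, and $w_{f_h}(x,v)=u_{f_h}(x)-v$. It is assumed that $n_{f_h^{k+1}}\neq0$ wherever $u$ and $\theta$ are evaluated. Lenard--Bernstein form: $$\begin{aligned}B_h^{\mathrm{LB}}(f_h,\boldsymbol\rho_{f_h},\varphi_h)_{ij}={}&\int_{I_i^x}\big[\widehat{w_{f_h}f_h}(x,v_{j+1/2})\varphi_h(x,v_{j+1/2}^-)-\widehat{w_{f_h}f_h}(x,v_{j-1/2})\varphi_h(x,v_{j-1/2}^+)\big]dx-(w_{f_h}f_h,\partial_v\varphi_h)_{ij}\\&-\int_{I_i^x}\theta_{f_h}\Big\{\big[\partial_v\mathfrak f_h(x,v_{j+1/2})\varphi_h(x,v_{j+1/2}^-)-\mathfrak f_h(x,v_{j+1/2})\partial_v\varphi_h(x,v_{j+1/2}^-)\big]\\&\qquad-\big[\partial_v\mathfrak f_h(x,v_{j-1/2})\varphi_h(x,v_{j-1/2}^+)-\mathfrak f_h(x,v_{j-1/2})\partial_v\varphi_h(x,v_{j-1/2}^+)\big]\Big\}dx-(\theta_{f_h}f_h,\partial_{vv}\varphi_h)_{ij}.\end{aligned}$$ Here at interior velocity interfaces the upwind flux is $\widehat{w_{f_h}f_h}(x,v)=\frac{w_{f_h}+|w_{f_h}|}{2}f_h(x,v^-)+\frac{w_{f_h}-|w_{f_h}|}{2}f_h(x,v^+)$, and $\mathfrak f_h$ near $v_{j+1/2}$ is the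 recovery polynomial: the unique polynomial on $I_i^x\times(v_{j-1/2},v_{j+3/2})$ of degree at most $p$ in $x$ and at most $2p+1$ in $v$ with $(\mathfrak f_h,\varphi_h)_{ij}=(f_h,\varphi_h)_{ij}$ and $(\mathfrak f_h,\varphi_h)_{i,j+1}=(f_h,\varphi_h)_{i,j+1}$ for all $\varphi_h\in\mathbb{V}_h^p$. At the velocity boundaries one imposes: $\widehat{w_{f_h}f_h}-\theta_{f_h}\partial_v\mathfrak f_h=0$ and $\mathfrak f_h=0$ at $v=v_{\min}$ and at $v=v_{\max}$. Only spatial integrals are approximated by quadrature; velocity integrals are exact, and the inner products $(f_h^{k+1},\varphi_h)_{ij}$, $(f_h^\star,\varphi_h)_{ij}$ are exact. *)

theory Defs
  imports "HOL-Analysis.Analysis" "HOL-Computational_Algebra.Polynomial"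
begin

(* Faces are numbered from 0: xb M i is x_{i+1/2} and vb M j is v_{j+1/2}.  Hence element i >= 1
   lies between the faces i - 1 and i, and the domain boundaries are the faces 0 and Nx (Nv). *)

record mesh =
  Nx :: nat
  Nv :: nat
  xb :: "nat \<Rightarrow> real"
  vb :: "nat \<Rightarrow> real"

definition valid_mesh :: "mesh \<Rightarrow> bool" where
  "valid_mesh M \<longleftrightarrow> 1 \<le> Nx M \<and> 1 \<le> Nv M \<and>
     strict_mono_on {0..Nx M} (xb M) \<and> strict_mono_on {0..Nv M} (vb M)"

definition Ix :: "mesh \<Rightarrow> nat \<Rightarrow> real set" where
  "Ix M i = {xb M (i - 1)<..<xb M i}"

definition Iv :: "mesh \<Rightarrow> nat \<Rightarrow> real set" where
  "Iv M j = {vb M (j - 1)<..<vb M j}"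

definition Dv :: "mesh \<Rightarrow> real set" where
  "Dv M = {vb M 0..vb M (Nv M)}"

definition dx :: "mesh \<Rightarrow> nat \<Rightarrow> real" where
  "dx M i = xb M i - xb M (i - 1)"

definition bipoly :: "nat \<Rightarrow> nat \<Rightarrow> (real \<Rightarrow> real \<Rightarrow> real) \<Rightarrow> bool" where
  "bipoly r s g \<longleftrightarrow>
     (\<exists>c :: nat \<Rightarrow> nat \<Rightarrow> real. \<forall>x v. g x v = (\<Sum>a\<le>r. \<Sum>b\<le>s. c a b * x ^ a * v ^ b))"

(* Values on the faces and outside the domain are unconstrained: only one-sided limits at the
   faces, values inside the elements and integrals are ever used. *)
definition Vh :: "nat \<Rightarrow> mesh \<Rightarrow> (real \<Rightarrow> real \<Rightarrow> real) set" where
  "Vh p M = {f. \<forall>i\<in>{1..Nx M}. \<forall>j\<in>{1..Nv M}.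
                 \<exists>g. bipoly p p g \<and> (\<forall>x\<in>Ix M i. \<forall>v\<in>Iv M j. f x v = g x v)}"

definition ip :: "mesh \<Rightarrow> nat \<Rightarrow> nat \<Rightarrow> (real \<Rightarrow> real \<Rightarrow> real) \<Rightarrow> (real \<Rightarrow> real \<Rightarrow> real) \<Rightarrow> real" where
  "ip M i j a b = integral (Ix M i \<times> Iv M j) (\<lambda>(x, v). a x v * b x v)"

definition dens :: "mesh \<Rightarrow> (real \<Rightarrow> real \<Rightarrow> real) \<Rightarrow> real \<Rightarrow> real" where
  "dens M f x = integral (Dv M) (\<lambda>v. f x v)"

definition vel :: "mesh \<Rightarrow> (real \<Rightarrow> real \<Rightarrow> real) \<Rightarrow> real \<Rightarrow> real" where
  "vel M f x = 1 / dens M f x * integral (Dv M) (\<lambda>v. v * f x v)"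

definition temp :: "mesh \<Rightarrow> (real \<Rightarrow> real \<Rightarrow> real) \<Rightarrow> real \<Rightarrow> real" where
  "temp M f x = 1 / dens M f x * integral (Dv M) (\<lambda>v. (v - vel M f x)\<^sup>2 * f x v)"

definition relvel :: "mesh \<Rightarrow> (real \<Rightarrow> real \<Rightarrow> real) \<Rightarrow> real \<Rightarrow> real \<Rightarrow> real" where
  "relvel M f x v = vel M f x - v"

definition evec :: "real \<Rightarrow> real ^ 3" where
  "evec v = vector [1, v, v\<^sup>2 / 2]"

definition nodal_moments :: "mesh \<Rightarrow> (real \<Rightarrow> real \<Rightarrow> real) \<Rightarrow> real \<Rightarrow> real ^ 3" where
  "nodal_moments M f x = (\<Sum>j = 1..Nv M. integral (Iv M j) (\<lambda>v. f x v *\<^sub>R evec v))"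

(* Rodrigues' formula *)
definition legendre :: "nat \<Rightarrow> real poly" where
  "legendre n = smult (1 / (2 ^ n * fact n)) ((pderiv ^^ n) ([:-1, 0, 1:] ^ n))"

(* The n-point Gauss-Legendre nodes on (a,b): the zeros of the n-th Legendre polynomial, mapped
   affinely from (-1,1).  All its zeros lie in (-1,1), so none is lost by the restriction. *)
definition gauss_legendre_nodes :: "nat \<Rightarrow> real \<Rightarrow> real \<Rightarrow> real set" where
  "gauss_legendre_nodes n a b =
     {x \<in> {a<..<b}. poly (legendre n) ((2 * x - a - b) / (b - a)) = 0}"

definition Sx :: "nat \<Rightarrow> mesh \<Rightarrow> nat \<Rightarrow> real set" where
  "Sx p M i = gauss_legendre_nodes (p + 1) (xb M (i - 1)) (xb M i)"

abbreviation trace_below :: "(real \<Rightarrow> real) \<Rightarrow> real \<Rightarrow> real" where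
  "trace_below h v \<equiv> Lim (at_left v) h"

abbreviation trace_above :: "(real \<Rightarrow> real) \<Rightarrow> real \<Rightarrow> real" where
  "trace_above h v \<equiv> Lim (at_right v) h"

definition upwind :: "mesh \<Rightarrow> (real \<Rightarrow> real \<Rightarrow> real) \<Rightarrow> real \<Rightarrow> real \<Rightarrow> real" where
  "upwind M f x v =
     (relvel M f x v + \<bar>relvel M f x v\<bar>) / 2 * trace_below (f x) v +
     (relvel M f x v - \<bar>relvel M f x v\<bar>) / 2 * trace_above (f x) v"

(* The recovery polynomial across the interior velocity face j (between cells j and j + 1) *)
definition recovery ::
    "nat \<Rightarrow> mesh \<Rightarrow> (real \<Rightarrow> real \<Rightarrow> real) \<Rightarrow> nat \<Rightarrow> nat \<Rightarrow> real \<Rightarrow> real \<Rightarrow> real" where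
  "recovery p M f i j =
     (THE g. bipoly p (2 * p + 1) g \<and>
        (\<forall>\<phi>\<in>Vh p M. ip M i j g \<phi> = ip M i j f \<phi> \<and> ip M i (j + 1) g \<phi> = ip M i (j + 1) f \<phi>))"

(* W i j x is the flux of relvel * f, and R i j the recovered function, at face j of column i.
   Both are determined at interior faces.  At the two boundary faces the scheme does not define
   them separately, but only imposes the zero total flux and zero value conditions. *)
definition face_data ::
    "nat \<Rightarrow> mesh \<Rightarrow> (real \<Rightarrow> real \<Rightarrow> real) \<Rightarrow> (nat \<Rightarrow> nat \<Rightarrow> real \<Rightarrow> real) \<Rightarrow>
     (nat \<Rightarrow> nat \<Rightarrow> real \<Rightarrow> real \<Rightarrow> real) \<Rightarrow> bool" where
  "face_data p M f W R \<longleftrightarrow>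
     (\<forall>i\<in>{1..Nx M}. \<forall>j\<in>{1..<Nv M}.
        R i j = recovery p M f i j \<and> (\<forall>x\<in>Ix M i. W i j x = upwind M f x (vb M j))) \<and>
     (\<forall>i\<in>{1..Nx M}. \<forall>j\<in>{0, Nv M}. \<forall>x\<in>Ix M i.
        W i j x - temp M f x * deriv (R i j x) (vb M j) = 0 \<and> R i j x (vb M j) = 0)"

(* The Lenard-Bernstein form.  Q i stands for the integral over Ix M i, so that
   Q i = integral (Ix M i) gives the exact form and a quadrature rule its discrete version;
   the velocity integrals are exact in either case. *)
definition LB_form ::
    "(nat \<Rightarrow> (real \<Rightarrow> real) \<Rightarrow> real) \<Rightarrow> mesh \<Rightarrow> (nat \<Rightarrow> nat \<Rightarrow> real \<Rightarrow> real) \<Rightarrow>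
     (nat \<Rightarrow> nat \<Rightarrow> real \<Rightarrow> real \<Rightarrow> real) \<Rightarrow> (real \<Rightarrow> real \<Rightarrow> real) \<Rightarrow> (real \<Rightarrow> real \<Rightarrow> real) \<Rightarrow>
     nat \<Rightarrow> nat \<Rightarrow> real" where
  "LB_form Q M W R f \<phi> i j =
     Q i (\<lambda>x. W i j x * trace_below (\<phi> x) (vb M j)
              - W i (j - 1) x * trace_above (\<phi> x) (vb M (j - 1)))
     - Q i (\<lambda>x. integral (Iv M j) (\<lambda>v. relvel M f x v * f x v * deriv (\<phi> x) v))
     - Q i (\<lambda>x. temp M f x *
          ((deriv (R i j x) (vb M j) * trace_below (\<phi> x) (vb M j)
            - R i j x (vb M j) * trace_below (deriv (\<phi> x)) (vb M j))
         - (deriv (R i (j - 1) x) (vb M (j - 1)) * trace_above (\<phi> x) (vb M (j - 1))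
            - R i (j - 1) x (vb M (j - 1)) * trace_above (deriv (\<phi> x)) (vb M (j - 1)))))
     - Q i (\<lambda>x. integral (Iv M j) (\<lambda>v. temp M f x * f x v * deriv (deriv (\<phi> x)) v))"

definition quadrature ::
    "mesh \<Rightarrow> nat \<Rightarrow> (nat \<Rightarrow> real) \<Rightarrow> (nat \<Rightarrow> nat \<Rightarrow> real) \<Rightarrow> nat \<Rightarrow> (real \<Rightarrow> real) \<Rightarrow> real" where
  "quadrature M N wt pt i F = dx M i * (\<Sum>m = 1..N. wt m * F (pt i m))"

end

theory Submission
  imports Defs
begin

text \<open>
  The collision operator acts in velocity only and has the collision invariants \<open>1\<close>,
  \<open>v\<close> and \<open>v\<^sup>2 / 2\<close> at every point of space separately.  The weak form
  sees this through the test functions \<open>\<phi>(x, v) = l(x) q(v)\<close> with \<open>l\<close> an arbitrary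
  polynomial of degree at most \<open>p\<close> and \<open>q\<close> of degree at most 2; they belong to the
  discrete space because \<open>p \<ge> 2\<close>.

  For such a test function the sum of the form over the velocity cells of one column vanishes,
  because its integrand already does so at each quadrature point (\<open>sum_LB_form_eq_0\<close>).
  As \<open>\<phi>\<close> is smooth across the velocity faces, the face terms telescope, and the boundary conditions remove the two terms
  that are left.  The volume terms sum to the integral of
  \<open>((u - v) q' + \<theta> q'') f\<close> over the velocity domain, which is zero because
  \<open>u\<close> and \<open>\<theta>\<close> are the velocity and temperature of \<open>f\<close> itself,
  well defined at the quadrature points since the density does not vanish there
  (\<open>collision_invariant\<close>).

  The update therefore leaves the integral over a space cell of \<open>l\<close> times the moment
  of \<open>f\<close> against \<open>q\<close> unchanged, for every \<open>l\<close>.  On a space cell that moment is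
  itself a polynomial of degree at most \<open>p\<close> (\<open>velocity_moment_polynomial\<close>), so the
  change of the moment may be chosen as \<open>l\<close>: the integral of its square vanishes, and
  with it the change itself (\<open>velocity_moment_eq_if_tested_eq\<close>).  Conservation thus
  holds at every point of the open space cell, in particular at the Gauss-Legendre nodes.
\<close>

section \<open>Cells and velocity integrals\<close>

lemma space_faces_less:
  assumes "valid_mesh M" "i \<in> {1..Nx M}"
  shows "xb M (i - 1) < xb M i"
  using assms unfolding valid_mesh_def by (intro strict_mono_onD[of "{0..Nx M}" "xb M"]) auto

text \<open>
  The values of \<open>h\<close> on the velocity faces are arbitrary, but the faces are finitely many, so
  integrability on the open cells already gives the integral over the closed domain.
\<close>

lemma has_integral_Dv:
  fixes h :: "real \<Rightarrow> 'a::banach"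
  assumes M: "valid_mesh M"
    and int: "\<And>j. j \<in> {1..Nv M} \<Longrightarrow> h integrable_on Iv M j"
  shows "(h has_integral (\<Sum>j = 1..Nv M. integral (Iv M j) h)) (Dv M)"
proof -
  have mono: "vb M a \<le> vb M b" if "a \<le> b" "b \<le> Nv M" for a b
    using M that unfolding valid_mesh_def
    by (intro strict_mono_on_leD[of "{0..Nv M}" "vb M"]) auto
  have "(h has_integral (\<Sum>j = 1..n. integral (Iv M j) h)) {vb M 0..vb M n}" if "n \<le> Nv M" for n
    using that
  proof (induction n)
    case 0
    then show ?case using has_integral_refl(2)[of h "vb M 0"] by simp
  next
    case (Suc n)
    have "(h has_integral integral (Iv M (Suc n)) h) (Iv M (Suc n))"
      using int[of "Suc n"] Suc.prems by (simp add: integrable_integral)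
    then have "(h has_integral integral (Iv M (Suc n)) h) {vb M n..vb M (Suc n)}"
      using has_integral_open_interval[of h _ "vb M n" "vb M (Suc n)"] by (simp add: Iv_def)
    then show ?case
      using has_integral_combine[of "vb M 0" "vb M n" "vb M (Suc n)" h] Suc mono[of 0 n]
        mono[of n "Suc n"] by simp
  qed
  then show ?thesis by (simp add: Dv_def)
qed

lemma bipoly_continuous_on:
  assumes "bipoly r s g"
  shows "continuous_on A (\<lambda>z. g (fst z) (snd z))"
proof -
  obtain c where "\<And>x v. g x v = (\<Sum>a\<le>r. \<Sum>b\<le>s. c a b * x ^ a * v ^ b)"
    using assms unfolding bipoly_def by blast
  then show ?thesis by (auto intro!: continuous_intros)
qed

lemma bipoly_continuous_on_velocity:
  assumes "bipoly r s g"
  shows "continuous_on A (g x)"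
proof -
  obtain c where "\<And>x v. g x v = (\<Sum>a\<le>r. \<Sum>b\<le>s. c a b * x ^ a * v ^ b)"
    using assms unfolding bipoly_def by blast
  then have "g x = (\<lambda>v. \<Sum>a\<le>r. \<Sum>b\<le>s. c a b * x ^ a * v ^ b)" by auto
  then show ?thesis by (auto intro!: continuous_intros)
qed

lemma Vh_integrable_on_Iv:
  assumes "f \<in> Vh p M" "i \<in> {1..Nx M}" "j \<in> {1..Nv M}" "x \<in> Ix M i"
    and k: "continuous_on UNIV k"
  shows "(\<lambda>v. f x v * k v) integrable_on Iv M j"
proof -
  obtain g where g: "bipoly p p g" "\<And>v. v \<in> Iv M j \<Longrightarrow> f x v = g x v"
    using assms unfolding Vh_def by blast
  have "(\<lambda>v. g x v * k v) integrable_on {vb M (j - 1)..vb M j}"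
    by (intro integrable_continuous_interval continuous_intros bipoly_continuous_on_velocity[OF g(1)]
        continuous_on_subset[OF k]) auto
  then have "(\<lambda>v. g x v * k v) integrable_on Iv M j"
    by (simp add: Iv_def integrable_on_open_interval_real)
  then show ?thesis
    by (rule integrable_eq) (simp add: g)
qed

lemma Vh_has_integral_Dv:
  assumes "valid_mesh M" "f \<in> Vh p M" "i \<in> {1..Nx M}" "x \<in> Ix M i" "continuous_on UNIV k"
  shows "((\<lambda>v. f x v * k v) has_integral (\<Sum>j = 1..Nv M. integral (Iv M j) (\<lambda>v. f x v * k v))) (Dv M)"
  by (intro has_integral_Dv Vh_integrable_on_Iv[OF assms(2,3)] assms)

section \<open>Velocity moments are polynomials in space\<close>

lemma Vh_poly_times_poly:
  assumes "degree l \<le> p" "degree q \<le> p"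
  shows "(\<lambda>x v. poly l x * poly q v) \<in> Vh p M"
proof -
  have ex: "poly r x = (\<Sum>a\<le>p. coeff r a * x ^ a)" if "degree r \<le> p" for r :: "real poly" and x
  proof -
    have "(\<Sum>a\<le>p. coeff r a * x ^ a) = (\<Sum>a\<le>degree r. coeff r a * x ^ a)"
      using that by (intro sum.mono_neutral_right) (auto simp: coeff_eq_0)
    then show ?thesis by (simp add: poly_altdef)
  qed
  have "bipoly p p (\<lambda>x v. poly l x * poly q v)"
    unfolding bipoly_def
    by (rule exI[of _ "\<lambda>a b. coeff l a * coeff q b"])
       (simp add: ex assms sum_product mult_ac)
  then show ?thesis unfolding Vh_def by blast
qed

text \<open>
  On a cell \<open>f\<close> is a polynomial in \<open>x\<close> whose coefficients are polynomials in \<open>v\<close>;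
  integrating these against \<open>q\<close> gives the coefficients of \<open>P\<close>.  The last conclusion is
  Fubini's theorem, applied to the polynomial on the closed cell, where it is continuous.
\<close>

lemma cell_moment_polynomial:
  assumes "f \<in> Vh p M" "i \<in> {1..Nx M}" "j \<in> {1..Nv M}"
  obtains P where "degree P \<le> p"
    "\<And>x. x \<in> Ix M i \<Longrightarrow> integral (Iv M j) (\<lambda>v. f x v * poly q v) = poly P x"
    "\<And>l. ip M i j f (\<lambda>x v. poly l x * poly q v) = integral (Ix M i) (\<lambda>x. poly l x * poly P x)"
proof -
  obtain g where g: "bipoly p p g" "\<And>x v. x \<in> Ix M i \<Longrightarrow> v \<in> Iv M j \<Longrightarrow> f x v = g x v"
    using assms unfolding Vh_def by blast
  obtain c where c: "\<And>x v. g x v = (\<Sum>a\<le>p. \<Sum>b\<le>p. c a b * x ^ a * v ^ b)"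
    using g unfolding bipoly_def by blast
  let ?a = "xb M (i - 1)" and ?b = "xb M i" and ?c = "vb M (j - 1)" and ?d = "vb M j"
  define P where "P = (\<Sum>a\<le>p. monom (integral (Iv M j) (\<lambda>v. (\<Sum>b\<le>p. c a b * v ^ b) * poly q v)) a)"
  have deg: "degree P \<le> p"
    unfolding P_def by (rule degree_sum_le) (simp_all add: order.trans[OF degree_monom_le])
  have mom: "integral (Iv M j) (\<lambda>v. g x v * poly q v) = poly P x" for x
  proof -
    have int: "(\<lambda>v. (\<Sum>b\<le>p. c a b * v ^ b) * poly q v) integrable_on Iv M j" for a
      unfolding Iv_def integrable_on_open_interval_real
      by (intro integrable_continuous_interval continuous_intros)
    have "integral (Iv M j) (\<lambda>v. g x v * poly q v)
        = integral (Iv M j) (\<lambda>v. \<Sum>a\<le>p. x ^ a * ((\<Sum>b\<le>p. c a b * v ^ b) * poly q v))"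
      by (simp add: c sum_distrib_left sum_distrib_right mult_ac)
    also have "\<dots> = (\<Sum>a\<le>p. integral (Iv M j) (\<lambda>v. x ^ a * ((\<Sum>b\<le>p. c a b * v ^ b) * poly q v)))"
      by (rule integral_sum) (auto intro!: integrable_on_mult_right int)
    also have "\<dots> = poly P x"
      by (simp add: P_def poly_sum poly_monom mult.commute)
    finally show ?thesis .
  qed
  have momf: "integral (Iv M j) (\<lambda>v. f x v * poly q v) = poly P x" if "x \<in> Ix M i" for x
    unfolding mom[symmetric] by (rule integral_cong) (simp add: g that)
  have ip: "ip M i j f (\<lambda>x v. poly l x * poly q v) = integral (Ix M i) (\<lambda>x. poly l x * poly P x)" for l
  proof -
    let ?h = "\<lambda>(x, v). g x v * (poly l x * poly q v)"
    have box: "Ix M i \<times> Iv M j = box (?a, ?c) (?b, ?d)"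
      by (simp add: box_prod Ix_def Iv_def)
    have "ip M i j f (\<lambda>x v. poly l x * poly q v) = integral (Ix M i \<times> Iv M j) ?h"
      unfolding ip_def by (rule integral_cong) (auto simp: g)
    also have "\<dots> = integral (cbox (?a, ?c) (?b, ?d)) ?h"
      by (simp only: box integral_open_interval)
    also have "\<dots> = integral (cbox ?a ?b) (\<lambda>x. integral (cbox ?c ?d) (\<lambda>v. ?h (x, v)))"
      by (rule integral_prod_continuous)
         (auto simp: case_prod_beta intro!: continuous_intros bipoly_continuous_on[OF g(1)])
    also have "\<dots> = integral (Ix M i) (\<lambda>x. integral (Iv M j) (\<lambda>v. poly l x * (g x v * poly q v)))"
      by (simp add: Ix_def Iv_def integral_open_interval_real mult_ac)
    also have "\<dots> = integral (Ix M i) (\<lambda>x. poly l x * poly P x)"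
      by (simp only: integral_mult_right mom)
    finally show ?thesis .
  qed
  show thesis using that deg momf ip by blast
qed

definition velocity_moment :: "mesh \<Rightarrow> (real \<Rightarrow> real \<Rightarrow> real) \<Rightarrow> real poly \<Rightarrow> real \<Rightarrow> real" where
  "velocity_moment M f q x = (\<Sum>j = 1..Nv M. integral (Iv M j) (\<lambda>v. f x v * poly q v))"

text \<open>
  One and the same polynomial represents the moment pointwise and in the weak form, which is
  what allows a weak identity to be turned into a pointwise one.
\<close>

lemma velocity_moment_polynomial:
  assumes "f \<in> Vh p M" "i \<in> {1..Nx M}"
  shows "\<exists>P. degree P \<le> p \<and> (\<forall>x\<in>Ix M i. velocity_moment M f q x = poly P x) \<and>
    (\<forall>l. (\<Sum>j = 1..Nv M. ip M i j f (\<lambda>x v. poly l x * poly q v))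
        = integral (Ix M i) (\<lambda>x. poly l x * poly P x))"
proof -
  have "\<forall>j\<in>{1..Nv M}. \<exists>P. degree P \<le> p \<and>
      (\<forall>x\<in>Ix M i. integral (Iv M j) (\<lambda>v. f x v * poly q v) = poly P x) \<and>
      (\<forall>l. ip M i j f (\<lambda>x v. poly l x * poly q v) = integral (Ix M i) (\<lambda>x. poly l x * poly P x))"
  proof
    fix j
    assume j: "j \<in> {1..Nv M}"
    show "\<exists>P. degree P \<le> p \<and>
      (\<forall>x\<in>Ix M i. integral (Iv M j) (\<lambda>v. f x v * poly q v) = poly P x) \<and>
      (\<forall>l. ip M i j f (\<lambda>x v. poly l x * poly q v) = integral (Ix M i) (\<lambda>x. poly l x * poly P x))"
      by (rule cell_moment_polynomial[OF assms j, of q]) blast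
  qed
  from bchoice[OF this] obtain P where P: "\<And>j. j \<in> {1..Nv M} \<Longrightarrow> degree (P j) \<le> p"
      "\<And>j x. j \<in> {1..Nv M} \<Longrightarrow> x \<in> Ix M i \<Longrightarrow>
        integral (Iv M j) (\<lambda>v. f x v * poly q v) = poly (P j) x"
      "\<And>j l. j \<in> {1..Nv M} \<Longrightarrow> ip M i j f (\<lambda>x v. poly l x * poly q v)
        = integral (Ix M i) (\<lambda>x. poly l x * poly (P j) x)"
    by blast
  show ?thesis
  proof (intro exI[of _ "\<Sum>j = 1..Nv M. P j"] conjI ballI allI)
    show "degree (\<Sum>j = 1..Nv M. P j) \<le> p"
      by (rule degree_sum_le) (auto simp: P)
    show "velocity_moment M f q x = poly (\<Sum>j = 1..Nv M. P j) x" if "x \<in> Ix M i" for x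
      using that by (simp add: velocity_moment_def poly_sum P)
    fix l
    have "integral (Ix M i) (\<lambda>x. poly l x * poly (\<Sum>j = 1..Nv M. P j) x)
        = integral (Ix M i) (\<lambda>x. \<Sum>j = 1..Nv M. poly l x * poly (P j) x)"
      by (simp add: poly_sum sum_distrib_left)
    also have "\<dots> = (\<Sum>j = 1..Nv M. integral (Ix M i) (\<lambda>x. poly l x * poly (P j) x))"
      by (rule integral_sum)
         (auto simp: Ix_def integrable_on_open_interval_real
           intro!: integrable_continuous_interval continuous_intros)
    also have "\<dots> = (\<Sum>j = 1..Nv M. ip M i j f (\<lambda>x v. poly l x * poly q v))"
      by (simp add: P)
    finally show "(\<Sum>j = 1..Nv M. ip M i j f (\<lambda>x v. poly l x * poly q v))
        = integral (Ix M i) (\<lambda>x. poly l x * poly (\<Sum>j = 1..Nv M. P j) x)" ..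
  qed
qed

lemma poly_eq_0_if_integral_square_eq_0:
  fixes D :: "real poly"
  assumes "a < b" "integral {a<..<b} (\<lambda>x. poly D x * poly D x) = 0" "x \<in> {a<..<b}"
  shows "poly D x = 0"
proof -
  have "integral {a..b} (\<lambda>x. poly D x * poly D x) = 0"
    using assms(2) by (simp add: integral_open_interval_real)
  moreover have "continuous_on {a..b} (\<lambda>x. poly D x * poly D x)"
    by (intro continuous_intros)
  ultimately have "poly D x * poly D x = 0"
    using assms(1,3) integral_eq_0_iff[of a b "\<lambda>x. poly D x * poly D x"] by simp
  then show ?thesis by simp
qed

text \<open>
  The difference of the two moments has degree at most \<open>p\<close> in space, hence is an
  admissible factor \<open>l\<close>; tested against itself it must vanish.
\<close>

lemma velocity_moment_eq_if_tested_eq: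
  assumes "valid_mesh M" "f \<in> Vh p M" "g \<in> Vh p M" "i \<in> {1..Nx M}" "x \<in> Ix M i"
    and tested: "\<And>l. degree l \<le> p \<Longrightarrow>
      (\<Sum>j = 1..Nv M. ip M i j f (\<lambda>x v. poly l x * poly q v))
        = (\<Sum>j = 1..Nv M. ip M i j g (\<lambda>x v. poly l x * poly q v))"
  shows "velocity_moment M f q x = velocity_moment M g q x"
proof -
  from velocity_moment_polynomial[OF assms(2,4), of q] obtain P where
    "degree P \<le> p \<and> (\<forall>x\<in>Ix M i. velocity_moment M f q x = poly P x) \<and>
      (\<forall>l. (\<Sum>j = 1..Nv M. ip M i j f (\<lambda>x v. poly l x * poly q v))
        = integral (Ix M i) (\<lambda>x. poly l x * poly P x))" ..
  note P = this[THEN conjunct1] this[THEN conjunct2, THEN conjunct1, rule_format]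
    this[THEN conjunct2, THEN conjunct2, rule_format]
  from velocity_moment_polynomial[OF assms(3,4), of q] obtain S where
    "degree S \<le> p \<and> (\<forall>x\<in>Ix M i. velocity_moment M g q x = poly S x) \<and>
      (\<forall>l. (\<Sum>j = 1..Nv M. ip M i j g (\<lambda>x v. poly l x * poly q v))
        = integral (Ix M i) (\<lambda>x. poly l x * poly S x))" ..
  note S = this[THEN conjunct1] this[THEN conjunct2, THEN conjunct1, rule_format]
    this[THEN conjunct2, THEN conjunct2, rule_format]
  have int: "(\<lambda>x. poly r x * poly s x) integrable_on Ix M i" for r s :: "real poly"
    by (auto simp: Ix_def integrable_on_open_interval_real
        intro!: integrable_continuous_interval continuous_intros)
  have "integral (Ix M i) (\<lambda>x. poly (P - S) x * poly (P - S) x)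
      = integral (Ix M i) (\<lambda>x. poly (P - S) x * poly P x - poly (P - S) x * poly S x)"
    by (simp add: right_diff_distrib)
  also have "\<dots> = integral (Ix M i) (\<lambda>x. poly (P - S) x * poly P x)
      - integral (Ix M i) (\<lambda>x. poly (P - S) x * poly S x)"
    by (rule integral_diff[OF int int])
  also have "\<dots> = 0"
    using tested[OF degree_diff_le[OF P(1) S(1)]]
    unfolding P(3)[of "P - S"] S(3)[of "P - S"] by simp
  finally have "poly (P - S) x = 0"
    using poly_eq_0_if_integral_square_eq_0[OF space_faces_less[OF assms(1,4)]] assms(5)
    unfolding Ix_def by blast
  then show ?thesis using P(2) S(2) assms(5) by simp
qed

section \<open>Cancellation of the collision form\<close>

lemma trace_below_continuous:
  fixes h :: "real \<Rightarrow> real"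
  assumes "continuous_on UNIV h"
  shows "trace_below h v = h v"
proof (rule tendsto_Lim)
  show "(h \<longlongrightarrow> h v) (at_left v)"
    using assms by (simp add: continuous_on_def filterlim_at_split)
qed simp

lemma trace_above_continuous:
  fixes h :: "real \<Rightarrow> real"
  assumes "continuous_on UNIV h"
  shows "trace_above h v = h v"
proof (rule tendsto_Lim)
  show "(h \<longlongrightarrow> h v) (at_right v)"
    using assms by (simp add: continuous_on_def filterlim_at_split)
qed simp

lemma deriv_cmult_poly: "deriv (\<lambda>v. c * poly q v) = (\<lambda>v. c * poly (pderiv q) v)" for c :: real
  by (intro ext DERIV_imp_deriv) (auto intro!: derivative_eq_intros)

text \<open>
  With the moments \<open>m k\<close> of \<open>f\<close> against \<open>v ^ k\<close> and \<open>q' = b + 2 c v\<close>, the sum is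
  \<open>b (u m 0 - m 1) + 2 c (u m 1 - m 2 + \<theta> m 0)\<close>.  The definition of \<open>u\<close> makes the
  first bracket zero.  Expanding the square in the definition of \<open>\<theta>\<close> turns the second one
  into \<open>u (u m 0 - m 1)\<close>, so drag and diffusion balance in the energy.
\<close>

lemma collision_invariant:
  assumes M: "valid_mesh M" and f: "f \<in> Vh p M" "i \<in> {1..Nx M}" "x \<in> Ix M i"
    and n: "dens M f x \<noteq> 0" and q: "degree q \<le> 2"
  shows "(\<Sum>j = 1..Nv M. integral (Iv M j)
      (\<lambda>v. f x v * (relvel M f x v * poly (pderiv q) v + temp M f x * poly (pderiv (pderiv q)) v))) = 0"
proof -
  let ?u = "vel M f x" and ?t = "temp M f x"
  define m where "m k = integral (Dv M) (\<lambda>v. f x v * v ^ k)" for k :: nat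
  have hi: "((\<lambda>v. f x v * v ^ k) has_integral m k) (Dv M)" for k
    unfolding m_def
    by (intro integrable_integral has_integral_integrable[OF Vh_has_integral_Dv[OF M f]]
        continuous_intros)
  have m0: "m 0 = dens M f x" by (simp add: m_def dens_def)
  have u: "?u * m 0 = m 1"
    using n by (simp add: m0 vel_def) (simp add: m_def mult.commute)
  have "((\<lambda>v. f x v * v ^ 2 - 2 * ?u * (f x v * v ^ 1) + ?u ^ 2 * (f x v * v ^ 0))
      has_integral (m 2 - 2 * ?u * m 1 + ?u ^ 2 * m 0)) (Dv M)"
    by (intro has_integral_add has_integral_diff has_integral_mult_right hi)
  then have "((\<lambda>v. (v - ?u)\<^sup>2 * f x v) has_integral (m 2 - 2 * ?u * m 1 + ?u ^ 2 * m 0)) (Dv M)"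
    by (simp add: power2_diff algebra_simps)
  then have t: "?t * m 0 = m 2 - 2 * ?u * m 1 + ?u ^ 2 * m 0"
    using n by (simp add: m0 temp_def integral_unique)
  define b where "b = coeff q 1"
  define c where "c = coeff q 2"
  have q': "pderiv q = [:b, 2 * c:]"
  proof (rule poly_eqI)
    fix k
    have "coeff q (Suc k) = 0" if "k \<ge> 2" using q that by (intro coeff_eq_0) simp
    then show "coeff (pderiv q) k = coeff [:b, 2 * c:] k"
      by (cases k) (auto simp: coeff_pderiv b_def c_def numeral_2_eq_2 coeff_pCons split: nat.split)
  qed
  have "((\<lambda>v. b * ?u * (f x v * v ^ 0) - b * (f x v * v ^ 1) + 2 * c * ?u * (f x v * v ^ 1)
        - 2 * c * (f x v * v ^ 2) + 2 * c * ?t * (f x v * v ^ 0)) has_integral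
      (b * ?u * m 0 - b * m 1 + 2 * c * ?u * m 1 - 2 * c * m 2 + 2 * c * ?t * m 0)) (Dv M)"
    by (intro has_integral_add has_integral_diff has_integral_mult_right hi)
  moreover have "b * ?u * m 0 - b * m 1 + 2 * c * ?u * m 1 - 2 * c * m 2 + 2 * c * ?t * m 0 = 0"
  proof -
    have "?u * m 1 - m 2 + ?t * m 0 = ?u * (?u * m 0 - m 1)"
      unfolding t by (simp add: algebra_simps power2_eq_square)
    then have "b * (?u * m 0 - m 1) + 2 * c * (?u * m 1 - m 2 + ?t * m 0) = 0"
      using u by simp
    then show ?thesis by (simp add: algebra_simps)
  qed
  ultimately have "((\<lambda>v. b * ?u * (f x v * v ^ 0) - b * (f x v * v ^ 1) + 2 * c * ?u * (f x v * v ^ 1)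
        - 2 * c * (f x v * v ^ 2) + 2 * c * ?t * (f x v * v ^ 0)) has_integral 0) (Dv M)"
    by simp
  then have "((\<lambda>v. f x v * (relvel M f x v * poly (pderiv q) v + ?t * poly (pderiv (pderiv q)) v))
      has_integral 0) (Dv M)"
    by (rule has_integral_eq[rotated]) (simp add: q' pderiv_pCons relvel_def algebra_simps power2_eq_square)
  moreover have "continuous_on UNIV
      (\<lambda>v. relvel M f x v * poly (pderiv q) v + ?t * poly (pderiv (pderiv q)) v)"
    unfolding relvel_def by (intro continuous_intros)
  ultimately show ?thesis
    using Vh_has_integral_Dv[OF M f] has_integral_unique by blast
qed

text \<open>
  The form is split at each point \<open>x\<close> into the total flux \<open>G j x\<close> through face \<open>j\<close>,
  tested with \<open>\<phi>\<close>, and the volume term \<open>C j x\<close> of cell \<open>j\<close>.  The two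
  cells that share a face see the same flux there, since neither \<open>\<phi>\<close> nor its velocity
  derivative jumps there.
\<close>

lemma sum_LB_form_eq_0:
  assumes M: "valid_mesh M" and f: "f \<in> Vh p M" and i: "i \<in> {1..Nx M}"
    and pts: "\<And>m. m \<in> {1..N} \<Longrightarrow> pt i m \<in> Ix M i"
    and n: "\<And>m. m \<in> {1..N} \<Longrightarrow> dens M f (pt i m) \<noteq> 0"
    and fd: "face_data p M f W R" and q: "degree q \<le> 2"
  shows "(\<Sum>j = 1..Nv M. LB_form (quadrature M N wt pt) M W R f (\<lambda>x v. l x * poly q v) i j) = 0"
proof -
  define G where "G j x = W i j x * (l x * poly q (vb M j)) - temp M f x *
      (deriv (R i j x) (vb M j) * (l x * poly q (vb M j))
        - R i j x (vb M j) * (l x * poly (pderiv q) (vb M j)))" for j x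
  define C where "C j x = integral (Iv M j)
      (\<lambda>v. f x v * (relvel M f x v * poly (pderiv q) v + temp M f x * poly (pderiv (pderiv q)) v))" for j x
  have cont: "continuous_on UNIV (\<lambda>v. c * poly r v)" for c :: real and r
    by (intro continuous_intros)
  have vol: "integral (Iv M j) (\<lambda>v. relvel M f x v * f x v * (l x * poly (pderiv q) v))
      + integral (Iv M j) (\<lambda>v. temp M f x * f x v * (l x * poly (pderiv (pderiv q)) v)) = l x * C j x"
    if "j \<in> {1..Nv M}" "x \<in> Ix M i" for j x
  proof -
    have "(\<lambda>v. f x v * (relvel M f x v * (l x * poly (pderiv q) v))) integrable_on Iv M j"
      "(\<lambda>v. f x v * (temp M f x * (l x * poly (pderiv (pderiv q)) v))) integrable_on Iv M j"
      unfolding relvel_def by (intro Vh_integrable_on_Iv[OF f i] that continuous_intros)+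
    note integral_add[OF this, symmetric]
    then have "integral (Iv M j) (\<lambda>v. relvel M f x v * f x v * (l x * poly (pderiv q) v))
      + integral (Iv M j) (\<lambda>v. temp M f x * f x v * (l x * poly (pderiv (pderiv q)) v))
      = integral (Iv M j) (\<lambda>v. l x * (f x v * (relvel M f x v * poly (pderiv q) v
          + temp M f x * poly (pderiv (pderiv q)) v)))"
      by (simp add: algebra_simps)
    then show ?thesis by (simp add: C_def)
  qed
  have form: "LB_form (quadrature M N wt pt) M W R f (\<lambda>x v. l x * poly q v) i j
      = dx M i * (\<Sum>m = 1..N. wt m * (G j (pt i m) - G (j - 1) (pt i m) - l (pt i m) * C j (pt i m)))"
    if "j \<in> {1..Nv M}" for j
    unfolding LB_form_def quadrature_def right_diff_distrib[symmetric] sum_subtractf[symmetric]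
      deriv_cmult_poly trace_below_continuous[OF cont] trace_above_continuous[OF cont]
    by (intro arg_cong[where f = "(*) (dx M i)"] sum.cong refl)
       (simp add: vol[OF that pts, symmetric] G_def algebra_simps)
  have zero: "(\<Sum>j = 1..Nv M. G j x - G (j - 1) x - l x * C j x) = 0"
    if x: "x \<in> Ix M i" and nx: "dens M f x \<noteq> 0" for x
  proof -
    \<comment> \<open>Zero total flux cancels the terms with \<open>q\<close>; the zero recovered value is what
      cancels the term with \<open>q'\<close>, which the flux condition does not control.\<close>
    have bd: "G j x = 0" if "j \<in> {0, Nv M}" for j
    proof -
      have "W i j x - temp M f x * deriv (R i j x) (vb M j) = 0 \<and> R i j x (vb M j) = 0"
        using fd that x i unfolding face_data_def by blast
      then have "W i j x = temp M f x * deriv (R i j x) (vb M j)" "R i j x (vb M j) = 0"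
        by simp_all
      then show ?thesis by (simp add: G_def)
    qed
    have "(\<Sum>j = 1..Nv M. G j x - G (j - 1) x) = G (Nv M) x - G 0 x"
      using sum_telescope''[of 0 "Nv M" "\<lambda>j. G j x"] by (simp add: atLeastSucAtMost_greaterThanAtMost)
    moreover have "(\<Sum>j = 1..Nv M. C j x) = 0"
      unfolding C_def by (rule collision_invariant[OF M f i x nx q])
    ultimately show ?thesis
      by (simp add: sum_subtractf bd flip: sum_distrib_left)
  qed
  have "(\<Sum>j = 1..Nv M. LB_form (quadrature M N wt pt) M W R f (\<lambda>x v. l x * poly q v) i j)
      = dx M i * (\<Sum>m = 1..N. wt m *
          (\<Sum>j = 1..Nv M. G j (pt i m) - G (j - 1) (pt i m) - l (pt i m) * C j (pt i m)))"
    by (simp add: form sum_distrib_left) (rule sum.swap)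
  also have "\<dots> = dx M i * (\<Sum>m = 1..N. wt m * 0)"
    by (intro arg_cong[where f = "(*) (dx M i)"] sum.cong refl arg_cong[where f = "(*) (wt _)"]
        zero pts n)
  finally show ?thesis by simp
qed

section \<open>Conservation of the nodal moments\<close>

text \<open>
  Writing the components of \<open>evec\<close> as polynomials reduces the three conservation laws to
  one statement about test polynomials of degree at most 2.
\<close>

definition evec_poly :: "3 \<Rightarrow> real poly" where
  "evec_poly k = vector [1, [:0, 1:], [:0, 0, 1/2:]] $ k"

lemma poly_evec_poly: "poly (evec_poly k) v = evec v $ k"
  using exhaust_3[of k] by (auto simp: evec_poly_def evec_def vector_3 power2_eq_square)

lemma degree_evec_poly: "degree (evec_poly k) \<le> 2"
  using exhaust_3[of k] by (auto simp: evec_poly_def vector_3)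

lemma nodal_moments_nth:
  assumes "f \<in> Vh p M" "i \<in> {1..Nx M}" "x \<in> Ix M i"
  shows "nodal_moments M f x $ k = velocity_moment M f (evec_poly k) x"
proof -
  have "integral (Iv M j) (\<lambda>v. f x v *\<^sub>R evec v) $ k = integral (Iv M j) (\<lambda>v. f x v * evec v $ k)"
    if "j \<in> {1..Nv M}" for j
  proof -
    have comp: "(\<lambda>v. f x v * evec v $ k) integrable_on Iv M j" for k
      unfolding poly_evec_poly[symmetric]
      by (rule Vh_integrable_on_Iv[OF assms(1,2) that assms(3)]) (intro continuous_intros)
    have "(\<lambda>v. f x v *\<^sub>R evec v) integrable_on Iv M j"
    proof (rule integrable_componentwise)
      fix b :: "real ^ 3"
      assume "b \<in> Basis"
      then obtain k where "b = axis k 1" by (auto simp: Basis_vec_def)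
      then show "(\<lambda>v. (f x v *\<^sub>R evec v) \<bullet> b) integrable_on Iv M j"
        using comp[of k] by (simp add: inner_axis)
    qed
    from integral_component_eq_cart[OF this, of k] show ?thesis
      by simp
  qed
  then show ?thesis
    by (simp add: nodal_moments_def velocity_moment_def poly_evec_poly)
qed

theorem proposition4:
  fixes M :: mesh and p N :: nat and \<nu> \<Delta>t :: real
    and f fstar :: "real \<Rightarrow> real \<Rightarrow> real"
    and wt :: "nat \<Rightarrow> real" and pt :: "nat \<Rightarrow> nat \<Rightarrow> real"
    and W :: "nat \<Rightarrow> nat \<Rightarrow> real \<Rightarrow> real"
    and R :: "nat \<Rightarrow> nat \<Rightarrow> real \<Rightarrow> real \<Rightarrow> real"
  assumes "valid_mesh M"
    and "p \<ge> 2" and "\<nu> > 0" and "\<Delta>t > 0"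
    and "fstar \<in> Vh p M" and "f \<in> Vh p M"
    and quadrature_points: "\<forall>i\<in>{1..Nx M}. \<forall>m\<in>{1..N}. pt i m \<in> Ix M i"
    and density_nonzero: "\<forall>i\<in>{1..Nx M}. \<forall>m\<in>{1..N}. dens M f (pt i m) \<noteq> 0"
    and "face_data p M f W R"
    and update: "\<forall>\<phi>\<in>Vh p M. \<forall>i\<in>{1..Nx M}. \<forall>j\<in>{1..Nv M}.
        ip M i j f \<phi> = ip M i j fstar \<phi>
          - \<Delta>t * \<nu> * LB_form (quadrature M N wt pt) M W R f \<phi> i j"
  shows "\<forall>i\<in>{1..Nx M}. \<forall>x\<in>Sx p M i. nodal_moments M f x = nodal_moments M fstar x"
proof (intro ballI)
  fix i x
  assume i: "i \<in> {1..Nx M}" and "x \<in> Sx p M i"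
  then have x: "x \<in> Ix M i"
    by (simp add: Sx_def gauss_legendre_nodes_def Ix_def)
  have "velocity_moment M f (evec_poly k) x = velocity_moment M fstar (evec_poly k) x" for k
  proof (rule velocity_moment_eq_if_tested_eq[OF \<open>valid_mesh M\<close> \<open>f \<in> Vh p M\<close> \<open>fstar \<in> Vh p M\<close> i x])
    fix l :: "real poly"
    assume l: "degree l \<le> p"
    let ?\<phi> = "\<lambda>x v. poly l x * poly (evec_poly k) v"
    let ?B = "LB_form (quadrature M N wt pt) M W R f ?\<phi> i"
    have "?\<phi> \<in> Vh p M"
      using l degree_evec_poly[of k] \<open>p \<ge> 2\<close> by (intro Vh_poly_times_poly) auto
    then have "(\<Sum>j = 1..Nv M. ip M i j f ?\<phi>) = (\<Sum>j = 1..Nv M. ip M i j fstar ?\<phi> - \<Delta>t * \<nu> * ?B j)"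
      using update i by (intro sum.cong) auto
    also have "\<dots> = (\<Sum>j = 1..Nv M. ip M i j fstar ?\<phi>) - \<Delta>t * \<nu> * (\<Sum>j = 1..Nv M. ?B j)"
      by (simp only: sum_subtractf sum_distrib_left)
    also have "(\<Sum>j = 1..Nv M. ?B j) = 0"
      using quadrature_points density_nonzero i
      by (intro sum_LB_form_eq_0[OF \<open>valid_mesh M\<close> \<open>f \<in> Vh p M\<close> i _ _ \<open>face_data p M f W R\<close>
            degree_evec_poly]) auto
    finally show "(\<Sum>j = 1..Nv M. ip M i j f ?\<phi>) = (\<Sum>j = 1..Nv M. ip M i j fstar ?\<phi>)"
      by simp
  qed
  then show "nodal_moments M f x = nodal_moments M fstar x"
    by (simp add: vec_eq_iff nodal_moments_nth[OF \<open>f \<in> Vh p M\<close> i x]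
        nodal_moments_nth[OF \<open>fstar \<in> Vh p M\<close> i x])
qed

end
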